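(* Let $\mathbb F$ be a field, $n\ge 1$, and let $p$ and $q$ be monic polynomials over $\mathbb F$ of degree $n$ and $n-1$ respectively. Then $p$ and $q$ form an irreducible tridiagonal pair (ITrP) if and only if $p$ and $q$ form a proper pair.
   Context: A normalized tridiagonal matrix over $\mathbb F$ is an $n\times n$ matrix $A$ with diagonal entries $a_1,\dots,a_n\in\mathbb F$, all superdiagonal entries (positions $(i,i+1)$) equal to $1$, subdiagonal entries (positions $(i+1,i)$) $b_1,\dots,b_{n-1}\in\mathbb F$, and all other entries $0$. It is irreducible if $b_i\neq 0$ for all $i=1,\dots,n-1$. $A(1)$ denotes the trailing $(n-1)\times(n-1)$ principal submatrix of $A$ (delete the first row and column); the characteristic polynomial of the empty matrix is $1$. Monic polynomials $p,q$ over $\mathbb F$ of degrees $n,n-1$ form an irreducible tridiagonal pair (ITrP) if there is an irreducible normalized tridiagonal $n\times n$ matrix $A$ over $\mathbb F$ with $\det(tI-A)=p(t)$ and $\det(tI-A(1))=q(t)$. They form a proper pair if, when the (Euclidean) division algorithm is applied to $p$ and $q$, the degree of the remainder drops by exactly $1$ each time: setting $r_{-1}=p$, $r_0=q$ and letting $r_{i+1}$ be the remainder of the division of $r_{i-1}$ by $r_i$, one has $\deg r_i=n-1-i$ for all $i=0,1,\dots,n-1$ (so $r_{n-1}$ is a nonzero constant and the algorithm takes $n-1$ steps). *)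

theory Defs
  imports "Jordan_Normal_Form.Char_Poly"
begin

text \<open>Matrix indices are 0-based: the entry at position \<open>(i+1, j+1)\<close> of the usual
  numbering is \<open>A $$ (i, j)\<close>.\<close>

definition normalized_tridiagonal :: "nat \<Rightarrow> 'a::field mat \<Rightarrow> bool" where
  "normalized_tridiagonal n A \<longleftrightarrow>
     A \<in> carrier_mat n n \<and>
     (\<forall>i. Suc i < n \<longrightarrow> A $$ (i, Suc i) = 1) \<and>
     (\<forall>i<n. \<forall>j<n. Suc i < j \<or> Suc j < i \<longrightarrow> A $$ (i, j) = 0)"

definition irreducible_normalized_tridiagonal :: "nat \<Rightarrow> 'a::field mat \<Rightarrow> bool" where
  "irreducible_normalized_tridiagonal n A \<longleftrightarrow>
     normalized_tridiagonal n A \<and> (\<forall>i. Suc i < n \<longrightarrow> A $$ (Suc i, i) \<noteq> 0)"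

text \<open>\<open>char_poly A\<close> is \<open>det (t I - A)\<close>; for the \<open>0 \<times> 0\<close> matrix it is \<open>1\<close>.
  \<open>mat_delete A 0 0\<close> removes the first row and column.\<close>

definition ITrP :: "nat \<Rightarrow> 'a::field poly \<Rightarrow> 'a poly \<Rightarrow> bool" where
  "ITrP n p q \<longleftrightarrow>
     (\<exists>A. irreducible_normalized_tridiagonal n A \<and>
          char_poly A = p \<and> char_poly (mat_delete A 0 0) = q)"

text \<open>The remainder sequence is shifted by one, so that \<open>remainder_seq p q (Suc i)\<close> is \<open>r\<^sub>i\<close>
  in the numbering \<open>r\<^sub>-\<^sub>1 = p\<close>, \<open>r\<^sub>0 = q\<close>.\<close>

fun remainder_seq :: "'a::field poly \<Rightarrow> 'a poly \<Rightarrow> nat \<Rightarrow> 'a poly" where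
  "remainder_seq p q 0 = p"
| "remainder_seq p q (Suc 0) = q"
| "remainder_seq p q (Suc (Suc k)) = remainder_seq p q k mod remainder_seq p q (Suc k)"

text \<open>Since \<open>degree 0 = 0\<close>, non-vanishing has to be required explicitly; it matters
  for the last remainder, of degree \<open>0\<close>.\<close>

definition proper_pair :: "nat \<Rightarrow> 'a::field poly \<Rightarrow> 'a poly \<Rightarrow> bool" where
  "proper_pair n p q \<longleftrightarrow>
     (\<forall>i<n. remainder_seq p q (Suc i) \<noteq> 0 \<and> degree (remainder_seq p q (Suc i)) = n - 1 - i)"

end

theory Submission
  imports Defs
begin

text \<open>
  Both properties obey the same recursion in \<open>n\<close>. Let \<open>a\<close> and \<open>b\<close> be the first diagonal and the
  first subdiagonal entry of \<open>A\<close>, and let \<open>r\<close> be the characteristic polynomial of what remains of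
  \<open>A\<close> without its first two rows and columns. Expanding \<open>det (t I - A)\<close> along the first row and
  column (\<open>char_poly_tridiagonal\<close>) gives the three-term recurrence
  \<open>p = (t - a) q - b r\<close>. As \<open>deg r < deg q\<close>, this is also a division with remainder: the quotient of
  \<open>p\<close> by \<open>q\<close> is \<open>t - a\<close> and the remainder is \<open>- b r\<close>. Conversely, a division step in which the
  degree drops by exactly one has this form: the quotient is linear and monic because \<open>p\<close> and \<open>q\<close>
  are monic, and \<open>- b\<close> is the leading coefficient of the remainder, so \<open>b \<noteq> 0\<close>. The numbers \<open>a\<close>
  and \<open>b\<close> read off from it are the entries with which to enlarge a matrix for \<open>(q, r)\<close> to one for
  \<open>(p, q)\<close>.

  Hence \<open>ITrP\<close> passes from \<open>(p, q)\<close> to \<open>(q, r)\<close> (\<open>ITrP_Suc_Suc\<close>), while properness passes from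
  \<open>(p, q)\<close> to \<open>(q, - b r)\<close> (\<open>proper_pair_Suc_Suc\<close>). The two pairs differ only by a nonzero
  scalar, and rescaling the input of the Euclidean algorithm rescales every remainder without changing
  its degree (\<open>proper_pair_smult\<close>). The induction ends at \<open>n = 1\<close>, where both properties
  always hold.
\<close>

section \<open>Expanding a tridiagonal determinant along its border\<close>

text \<open>
  Only two terms of the expansion along row \<open>0\<close> survive. The minor belonging to \<open>M $$ (0, 1)\<close>
  has at most one nonzero entry in its first column, namely \<open>M $$ (1, 0)\<close>, and removing the row and column
  of that entry leaves \<open>M\<close> without its first two rows and columns.
\<close>

lemma det_tridiagonal_border:
  fixes M :: "'a::comm_ring_1 mat"
  assumes M: "M \<in> carrier_mat (Suc (Suc n)) (Suc (Suc n))"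
    and row: "\<And>j. 1 < j \<Longrightarrow> j < Suc (Suc n) \<Longrightarrow> M $$ (0, j) = 0"
    and col: "\<And>i. 1 < i \<Longrightarrow> i < Suc (Suc n) \<Longrightarrow> M $$ (i, 0) = 0"
  shows "det M = M $$ (0, 0) * det (mat_delete M 0 0)
    - M $$ (0, 1) * M $$ (1, 0) * det (mat_delete (mat_delete M 0 0) 0 0)"
proof -
  define N where "N = mat_delete M 0 1"
  have N: "N \<in> carrier_mat (Suc n) (Suc n)"
    using mat_delete_carrier[OF M, of 0 1] by (simp add: N_def)
  have N_col: "N $$ (i, 0) = (if i = 0 then M $$ (1, 0) else 0)" if "i < Suc n" for i
    using that M col[of "Suc i"] by (auto simp: N_def mat_delete_def)
  have N_delete: "mat_delete N 0 0 = mat_delete (mat_delete M 0 0) 0 0"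
    using M by (intro eq_matI) (auto simp: N_def mat_delete_def)
  have "det N = (\<Sum>i<Suc n. N $$ (i, 0) * cofactor N i 0)"
    by (rule laplace_expansion_column[OF N]) simp
  also have "\<dots> = N $$ (0, 0) * cofactor N 0 0 + (\<Sum>i<n. N $$ (Suc i, 0) * cofactor N (Suc i) 0)"
    by (rule sum.lessThan_Suc_shift)
  also have "\<dots> = M $$ (1, 0) * cofactor N 0 0"
    by (simp add: N_col)
  finally have det_N: "det N = M $$ (1, 0) * det (mat_delete (mat_delete M 0 0) 0 0)"
    by (simp add: cofactor_def N_delete)
  have "det M = (\<Sum>j<Suc (Suc n). M $$ (0, j) * cofactor M 0 j)"
    by (rule laplace_expansion_row[OF M]) simp
  also have "\<dots> = M $$ (0, 0) * cofactor M 0 0 + M $$ (0, 1) * cofactor M 0 1"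
    using row by (simp only: sum.lessThan_Suc_shift) simp
  finally show ?thesis
    using det_N by (simp add: cofactor_def N_def mult.assoc)
qed

lemma char_poly_matrix_mat_delete:
  assumes "A \<in> carrier_mat (Suc n) (Suc n)"
  shows "char_poly_matrix (mat_delete A 0 0) = mat_delete (char_poly_matrix A) 0 0"
  using assms by (intro eq_matI) (auto simp: char_poly_matrix_def mat_delete_def)

text \<open>
  The three-term recurrence. The off-diagonal product in \<open>t I - A\<close> is \<open>(- 1) (- b) = b\<close>, which
  is where the normalization of the superdiagonal enters.
\<close>

lemma char_poly_tridiagonal:
  fixes A :: "'a::field mat"
  assumes "normalized_tridiagonal (Suc (Suc n)) A"
  shows "char_poly A = [:- (A $$ (0, 0)), 1:] * char_poly (mat_delete A 0 0)
    - Polynomial.smult (A $$ (1, 0)) (char_poly (mat_delete (mat_delete A 0 0) 0 0))"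
proof -
  have A: "A \<in> carrier_mat (Suc (Suc n)) (Suc (Suc n))"
    and sup: "A $$ (0, Suc 0) = 1"
    and zero: "\<And>i j. i < Suc (Suc n) \<Longrightarrow> j < Suc (Suc n) \<Longrightarrow> Suc i < j \<or> Suc j < i \<Longrightarrow> A $$ (i, j) = 0"
    using assms by (auto simp: normalized_tridiagonal_def)
  have A1: "mat_delete A 0 0 \<in> carrier_mat (Suc n) (Suc n)"
    using mat_delete_carrier[OF A, of 0 0] by simp
  define C where "C = char_poly_matrix A"
  have C: "C \<in> carrier_mat (Suc (Suc n)) (Suc (Suc n))"
    using A by (simp add: C_def)
  have C00: "C $$ (0, 0) = [:- (A $$ (0, 0)), 1:]"
    and C01: "C $$ (0, 1) = - 1" and C10: "C $$ (1, 0) = [:- (A $$ (1, 0)):]"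
    using A sup by (simp_all add: C_def char_poly_matrix_def one_pCons)
  have "C $$ (0, j) = 0" if "1 < j" "j < Suc (Suc n)" for j
    using that A zero[of 0 j] by (simp add: C_def char_poly_matrix_def)
  moreover have "C $$ (i, 0) = 0" if "1 < i" "i < Suc (Suc n)" for i
    using that A zero[of i 0] by (simp add: C_def char_poly_matrix_def)
  ultimately have "det C = C $$ (0, 0) * det (mat_delete C 0 0)
      - C $$ (0, 1) * C $$ (1, 0) * det (mat_delete (mat_delete C 0 0) 0 0)"
    using det_tridiagonal_border[OF C] by blast
  then have "det C = [:- (A $$ (0, 0)), 1:] * det (mat_delete C 0 0)
      - Polynomial.smult (A $$ (1, 0)) (det (mat_delete (mat_delete C 0 0) 0 0))"
    unfolding C00 C01 C10 by simp
  then show ?thesis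
    unfolding char_poly_def char_poly_matrix_mat_delete[OF A1] char_poly_matrix_mat_delete[OF A]
      C_def .
qed

section \<open>Bordering an irreducible tridiagonal matrix\<close>

lemma irreducible_normalized_tridiagonal_mat_delete:
  assumes "irreducible_normalized_tridiagonal (Suc n) A"
  shows "irreducible_normalized_tridiagonal n (mat_delete A 0 0)"
  using assms
  by (auto simp: irreducible_normalized_tridiagonal_def normalized_tridiagonal_def mat_delete_def)

definition border :: "'a::field \<Rightarrow> 'a \<Rightarrow> 'a mat \<Rightarrow> 'a mat" where
  "border a b B = mat (Suc (dim_row B)) (Suc (dim_col B)) (\<lambda>(i, j).
     case (i, j) of
       (0, 0) \<Rightarrow> a
     | (0, Suc l) \<Rightarrow> if l = 0 then 1 else 0
     | (Suc k, 0) \<Rightarrow> if k = 0 then b else 0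
     | (Suc k, Suc l) \<Rightarrow> B $$ (k, l))"

lemma mat_delete_border: "mat_delete (border a b B) 0 0 = B"
  by (intro eq_matI) (auto simp: border_def mat_delete_def)

lemma irreducible_normalized_tridiagonal_border:
  assumes "irreducible_normalized_tridiagonal n B" and "b \<noteq> 0"
  shows "irreducible_normalized_tridiagonal (Suc n) (border a b B)"
  using assms
  by (auto simp: irreducible_normalized_tridiagonal_def normalized_tridiagonal_def border_def
      split: nat.splits)

lemma ITrP_monic_degree:
  assumes "ITrP (Suc n) p q"
  shows "monic p" "degree p = Suc n" "monic q" "degree q = n"
proof -
  obtain A where A: "A \<in> carrier_mat (Suc n) (Suc n)" "char_poly A = p"
      "char_poly (mat_delete A 0 0) = q"
    using assms
    by (auto simp: ITrP_def irreducible_normalized_tridiagonal_def normalized_tridiagonal_def)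
  have A1: "mat_delete A 0 0 \<in> carrier_mat n n"
    using mat_delete_carrier[OF A(1), of 0 0] by simp
  show "monic p" "degree p = Suc n" "monic q" "degree q = n"
    using degree_monic_char_poly[OF A(1)] degree_monic_char_poly[OF A1] A by auto
qed

lemma monic_degree_one:
  fixes p :: "'a::comm_ring_1 poly"
  assumes "monic p" "degree p = 1"
  obtains a where "p = [:- a, 1:]"
proof -
  have "p = [:- (- coeff p 0), 1:]"
    using assms by (intro poly_eqI)
      (auto simp: coeff_pCons coeff_eq_0 split: nat.split)
  then show ?thesis using that by blast
qed

lemma ITrP_one:
  fixes p q :: "'a::field poly"
  assumes "monic p" "degree p = 1" "monic q" "degree q = 0"
  shows "ITrP 1 p q"
proof -
  obtain a where p: "p = [:- a, 1:]"
    using assms(1,2) monic_degree_one by blast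
  have q: "q = 1"
    using assms(3,4) monic_degree_0 by blast
  have A: "border a 1 (mat 0 0 (\<lambda>_. 0)) \<in> carrier_mat 1 1"
    by (simp add: border_def)
  have "irreducible_normalized_tridiagonal 1 (border a 1 (mat 0 0 (\<lambda>_. 0)))"
    unfolding One_nat_def
    by (rule irreducible_normalized_tridiagonal_border)
      (auto simp: irreducible_normalized_tridiagonal_def normalized_tridiagonal_def)
  moreover have "char_poly (border a 1 (mat 0 0 (\<lambda>_. 0))) = p"
    using A by (simp add: char_poly_def det_single char_poly_matrix_def p border_def)
  moreover have "char_poly (mat_delete (border a 1 (mat 0 0 (\<lambda>_. 0))) 0 0) = q"
    by (simp add: mat_delete_border char_poly_def char_poly_matrix_def q)
  ultimately show ?thesis
    unfolding ITrP_def by blast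
qed

text \<open>
  From left to right \<open>r\<close> is the characteristic polynomial of the twice truncated matrix; from right to
  left any matrix realizing \<open>(q, r)\<close> is bordered by \<open>a\<close> and \<open>b\<close>.
\<close>

lemma ITrP_Suc_Suc:
  "ITrP (Suc (Suc n)) p q \<longleftrightarrow>
    (\<exists>a b r. b \<noteq> 0 \<and> ITrP (Suc n) q r \<and> p = [:- a, 1:] * q - Polynomial.smult b r)"
proof
  assume "ITrP (Suc (Suc n)) p q"
  then obtain A where A: "irreducible_normalized_tridiagonal (Suc (Suc n)) A"
      "char_poly A = p" "char_poly (mat_delete A 0 0) = q"
    unfolding ITrP_def by blast
  have "A $$ (1, 0) \<noteq> 0" and "normalized_tridiagonal (Suc (Suc n)) A"
    using A(1) by (auto simp: irreducible_normalized_tridiagonal_def)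
  moreover have "ITrP (Suc n) q (char_poly (mat_delete (mat_delete A 0 0) 0 0))"
    unfolding ITrP_def using irreducible_normalized_tridiagonal_mat_delete[OF A(1)] A(3) by blast
  ultimately show "\<exists>a b r. b \<noteq> 0 \<and> ITrP (Suc n) q r \<and> p = [:- a, 1:] * q - Polynomial.smult b r"
    using char_poly_tridiagonal A(2,3) by blast
next
  assume "\<exists>a b r. b \<noteq> 0 \<and> ITrP (Suc n) q r \<and> p = [:- a, 1:] * q - Polynomial.smult b r"
  then obtain a b B where b: "b \<noteq> 0"
    and B: "irreducible_normalized_tridiagonal (Suc n) B" "char_poly B = q"
    and p: "p = [:- a, 1:] * q - Polynomial.smult b (char_poly (mat_delete B 0 0))"
    unfolding ITrP_def by blast
  have A: "irreducible_normalized_tridiagonal (Suc (Suc n)) (border a b B)"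
    using irreducible_normalized_tridiagonal_border[OF B(1) b] .
  have "dim_row B = Suc n" "dim_col B = Suc n"
    using B(1) by (auto simp: irreducible_normalized_tridiagonal_def normalized_tridiagonal_def)
  then have "border a b B $$ (0, 0) = a" "border a b B $$ (1, 0) = b"
    by (auto simp: border_def)
  moreover have "normalized_tridiagonal (Suc (Suc n)) (border a b B)"
    using A by (simp add: irreducible_normalized_tridiagonal_def)
  ultimately have "char_poly (border a b B) = p"
    using char_poly_tridiagonal[of n "border a b B"] p B(2) by (simp add: mat_delete_border)
  then show "ITrP (Suc (Suc n)) p q"
    unfolding ITrP_def using A B(2) mat_delete_border by metis
qed

section \<open>Proper pairs and one step of division\<close>

lemma remainder_seq_Suc: "remainder_seq p q (Suc k) = remainder_seq q (p mod q) k"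
  by (induction k rule: induct_nat_012) simp_all

lemma proper_pair_Suc_Suc:
  "proper_pair (Suc (Suc n)) p q \<longleftrightarrow>
    q \<noteq> 0 \<and> degree q = Suc n \<and> proper_pair (Suc n) q (p mod q)"
  by (auto simp: proper_pair_def All_less_Suc2 remainder_seq_Suc[of p])

text \<open>
  The two scalars swap roles at each step: the remainder depends on the divisor only up to units
  and is linear in the dividend. This is why both must be arbitrary for the induction to work, and why
  the resulting factor \<open>e\<close> depends on the parity of \<open>k\<close>.
\<close>

lemma remainder_seq_smult:
  assumes "c \<noteq> 0" "d \<noteq> 0"
  shows "\<exists>e. e \<noteq> 0 \<and> remainder_seq (Polynomial.smult c p) (Polynomial.smult d q) k
    = Polynomial.smult e (remainder_seq p q k)"
  using assms
proof (induction k arbitrary: c d p q)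
  case 0
  then show ?case by auto
next
  case (Suc k)
  have "Polynomial.smult c p mod Polynomial.smult d q = Polynomial.smult c (p mod q)"
    using Suc.prems by (simp add: mod_smult_left mod_smult_right)
  then show ?case
    using Suc.IH[OF Suc.prems(2,1), of q "p mod q"] by (simp add: remainder_seq_Suc)
qed

text \<open>
  Needed because the remainder in a division step is not monic, whereas \<open>ITrP\<close> speaks about monic
  polynomials.
\<close>

lemma proper_pair_smult:
  assumes "c \<noteq> 0"
  shows "proper_pair n p (Polynomial.smult c q) \<longleftrightarrow> proper_pair n p q"
proof -
  have "remainder_seq p (Polynomial.smult c q) k = 0 \<longleftrightarrow> remainder_seq p q k = 0"
    "degree (remainder_seq p (Polynomial.smult c q) k) = degree (remainder_seq p q k)" for k
    using remainder_seq_smult[of 1 c p q k] assms by auto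
  then show ?thesis by (simp add: proper_pair_def)
qed

theorem theorem1:
  fixes p q :: "'a::field poly" and n :: nat
  assumes "n \<ge> 1"
    and "monic p" and "degree p = n"
    and "monic q" and "degree q = n - 1"
  shows "ITrP n p q \<longleftrightarrow> proper_pair n p q"
  using assms
proof (induction n arbitrary: p q rule: nat_induct_at_least)
  case base
  then have "proper_pair 1 p q"
    by (auto simp: proper_pair_def)
  moreover have "ITrP 1 p q"
    using base by (intro ITrP_one) auto
  ultimately show ?case by blast
next
  case (Suc m)
  then obtain n where m: "m = Suc n" by (cases m) auto
  have q: "q \<noteq> 0" "degree q = Suc n" "monic q" and p: "monic p" "degree p = Suc (Suc n)"
    using Suc.prems m by auto
  show ?case unfolding m
  proof
    assume "ITrP (Suc (Suc n)) p q"
    then obtain a b r where b: "b \<noteq> 0" and r: "ITrP (Suc n) q r"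
      and p_eq: "p = [:- a, 1:] * q - Polynomial.smult b r"
      unfolding ITrP_Suc_Suc by blast
    note r_monic = ITrP_monic_degree(3,4)[OF r]
    \<comment> \<open>The recurrence, read as division with remainder.\<close>
    have "p = Polynomial.smult (- b) r + q * [:- a, 1:]"
      unfolding p_eq by (simp add: mult.commute)
    then have "p mod q = Polynomial.smult (- b) r mod q"
      by (simp only: mod_mult_self2)
    also have "\<dots> = Polynomial.smult (- b) r"
      using b r_monic q by (intro mod_poly_less) simp
    finally have "p mod q = Polynomial.smult (- b) r" .
    moreover have "proper_pair (Suc n) q r"
      using Suc.IH[of q r] r r_monic q m by simp
    ultimately show "proper_pair (Suc (Suc n)) p q"
      using q b proper_pair_smult[of "- b"] by (simp add: proper_pair_Suc_Suc)
  next
    assume "proper_pair (Suc (Suc n)) p q"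
    then have proper: "proper_pair (Suc n) q (p mod q)"
      by (simp add: proper_pair_Suc_Suc)
    \<comment> \<open>The remainder is made monic before the induction hypothesis is applied; the scalar that is
      split off becomes the subdiagonal entry \<open>- c\<close>.\<close>
    define c where "c = lead_coeff (p mod q)"
    define r where "r = Polynomial.smult (inverse c) (p mod q)"
    have "p mod q \<noteq> 0" and deg: "degree (p mod q) = n"
      using proper by (auto simp: proper_pair_def dest: spec[of _ 0])
    then have c: "c \<noteq> 0"
      unfolding c_def using leading_coeff_neq_0 by blast
    then have r: "monic r" "degree r = n" "p mod q = Polynomial.smult c r"
      by (auto simp: r_def deg) (simp add: c_def deg)
    have "proper_pair (Suc n) q r"
      using proper proper_pair_smult[OF c] r(3) by metis
    then have ITrP_r: "ITrP (Suc n) q r"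
      using Suc.IH[of q r] r q m by simp
    \<comment> \<open>The remainder does not reach the top coefficient of \<open>p\<close>, so the degree and the leading
      coefficient of the quotient are forced by those of \<open>p\<close> and \<open>q\<close>.\<close>
    have div_nz: "p div q \<noteq> 0"
      using p q by (auto simp: div_poly_eq_0_iff)
    then have deg_prod: "degree (p div q * q) = degree (p div q) + Suc n"
      using q by (simp add: degree_mult_eq)
    then have mod_less: "degree (p mod q) < degree (p div q * q)"
      using deg by simp
    have "degree p = degree (p div q * q)"
      using degree_add_eq_left[OF mod_less] by (simp only: div_mult_mod_eq)
    moreover have "lead_coeff p = lead_coeff (p div q * q)"
      using lead_coeff_add_le[OF mod_less]
      by (simp only: add.commute[of "p mod q"] div_mult_mod_eq)
    ultimately have "degree (p div q) = 1" and "monic (p div q)"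
      using deg_prod p q by (simp, metis lead_coeff_mult mult.right_neutral)
    then obtain a where "p div q = [:- a, 1:]"
      using monic_degree_one by blast
    then have "p = [:- a, 1:] * q - Polynomial.smult (- c) r"
      using div_mult_mod_eq[of p q] r(3)
      by (metis diff_minus_eq_add smult_minus_left)
    then show "ITrP (Suc (Suc n)) p q"
      unfolding ITrP_Suc_Suc using ITrP_r c by (metis neg_equal_0_iff_equal)
  qed
qed

end
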